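(* The $W_+$-module $\mathrm{S}^2(W_+)$ is noetherian, i.e. every ascending chain of $W_+$-submodules of $\mathrm{S}^2(W_+)$ stabilises.
   Context: $\Bbbk$ is a field of characteristic zero. The positive Witt algebra $W_+$ is the Lie algebra over $\Bbbk$ with basis $\{e_n : n\in\mathbb{Z}_{\geq 1}\}$ and bracket $[e_i,e_j]=(j-i)e_{i+j}$. $\mathrm{S}^2(W_+)$ is the second symmetric power of $W_+$, with basis $\{x_ix_j: 1\le i\le j\}$ where $x_i$ is the image of $e_i$ in the symmetric algebra; $W_+$ acts on it by the action induced from the adjoint representation: $e_k\cdot(x_ix_j)=(i-k)x_{i+k}x_j+(j-k)x_ix_{j+k}$. *)

theory Defs
  imports Complex_Main "HOL-Library.Poly_Mapping"
begin

text \<open>Finitely supported functions \<^typ>\<open>'a \<Rightarrow>\<^sub>0 'k\<close> as the vector space with basis indexed by \<^typ>\<open>'a\<close>.\<close>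

definition fscale :: "'k::field \<Rightarrow> ('a \<Rightarrow>\<^sub>0 'k) \<Rightarrow> ('a \<Rightarrow>\<^sub>0 'k)" where
  "fscale c p = Poly_Mapping.map ((*) c) p"

lemma lookup_fscale [simp]:
  "Poly_Mapping.lookup (fscale c p) a = c * Poly_Mapping.lookup p a"
  unfolding fscale_def by transfer (simp add: when_def)

interpretation fsv: vector_space "fscale :: 'k::field \<Rightarrow> ('a \<Rightarrow>\<^sub>0 'k) \<Rightarrow> _"
  by unfold_locales (auto intro!: poly_mapping_eqI simp: lookup_add algebra_simps)

abbreviation bvec :: "'a \<Rightarrow> ('a \<Rightarrow>\<^sub>0 'k::field)" where
  "bvec a \<equiv> Poly_Mapping.single a 1"

text \<open>The linear extension of a map given on the basis vectors.\<close>

definition lext :: "('a \<Rightarrow> ('b \<Rightarrow>\<^sub>0 'k::field)) \<Rightarrow> ('a \<Rightarrow>\<^sub>0 'k) \<Rightarrow> ('b \<Rightarrow>\<^sub>0 'k)" where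
  "lext f p = (\<Sum>a\<in>Poly_Mapping.keys p. fscale (Poly_Mapping.lookup p a) (f a))"

text \<open>
  The positive Witt algebra: \<^term>\<open>bvec n\<close> is $e_n$, for $n \ge 1$.  The index type is
  \<^typ>\<open>nat\<close>, so the algebra is the subspace of vectors supported on positive indices.
\<close>

definition Wplus :: "(nat \<Rightarrow>\<^sub>0 'k::field) set" where
  "Wplus = {w. Poly_Mapping.keys w \<subseteq> {1..}}"

definition wbracket :: "(nat \<Rightarrow>\<^sub>0 'k::field) \<Rightarrow> (nat \<Rightarrow>\<^sub>0 'k) \<Rightarrow> (nat \<Rightarrow>\<^sub>0 'k)" where
  "wbracket u v =
    lext (\<lambda>i. lext (\<lambda>j. fscale (of_nat j - of_nat i) (bvec (i + j))) v) u"

text \<open>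
  The second symmetric power: \<^term>\<open>bvec (i, j)\<close> is $x_i x_j$, for $1 \le i \le j$.
  \<^term>\<open>symprod u v\<close> is the product $uv$ of two elements of the Lie algebra.
\<close>

definition S2Wplus :: "(nat \<times> nat \<Rightarrow>\<^sub>0 'k::field) set" where
  "S2Wplus = {v. Poly_Mapping.keys v \<subseteq> {(i, j). 1 \<le> i \<and> i \<le> j}}"

definition symprod :: "(nat \<Rightarrow>\<^sub>0 'k::field) \<Rightarrow> (nat \<Rightarrow>\<^sub>0 'k) \<Rightarrow> (nat \<times> nat \<Rightarrow>\<^sub>0 'k)" where
  "symprod u v = lext (\<lambda>i. lext (\<lambda>j. bvec (min i j, max i j)) v) u"

text \<open>The action induced by the adjoint representation, $w \cdot (uv) = [w,u] v + u [w,v]$.\<close>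

definition wact :: "(nat \<Rightarrow>\<^sub>0 'k::field) \<Rightarrow> (nat \<times> nat \<Rightarrow>\<^sub>0 'k) \<Rightarrow> (nat \<times> nat \<Rightarrow>\<^sub>0 'k)" where
  "wact w = lext (\<lambda>(i, j). symprod (wbracket w (bvec i)) (bvec j)
                         + symprod (bvec i) (wbracket w (bvec j)))"

definition S2_submodule :: "(nat \<times> nat \<Rightarrow>\<^sub>0 'k::field) set \<Rightarrow> bool" where
  "S2_submodule N \<longleftrightarrow>
    N \<subseteq> S2Wplus \<and> fsv.subspace N \<and> (\<forall>w\<in>Wplus. \<forall>v\<in>N. wact w v \<in> N)"


lemma lext_superset:
  assumes "finite A" "Poly_Mapping.keys p \<subseteq> A"
  shows "lext f p = (\<Sum>a\<in>A. fscale (Poly_Mapping.lookup p a) (f a))"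
  unfolding lext_def using assms by (intro sum.mono_neutral_left) (auto simp: in_keys_iff)

lemma lext_bvec [simp]: "lext f (bvec a) = f a"
  by (simp add: lext_def)

lemma lext_add: "lext f (p + q) = lext f p + lext f q"
proof -
  let ?A = "Poly_Mapping.keys p \<union> Poly_Mapping.keys q"
  have "lext f (p + q) = (\<Sum>a\<in>?A. fscale (Poly_Mapping.lookup (p + q) a) (f a))"
    using keys_add[of p q] by (intro lext_superset) auto
  then show ?thesis
    by (simp add: lext_superset[of ?A] lookup_add fsv.scale_left_distrib sum.distrib)
qed

lemma lext_scale: "lext f (fscale c p) = fscale c (lext f p)"
proof -
  have "lext f (fscale c p)
      = (\<Sum>a\<in>Poly_Mapping.keys p. fscale (Poly_Mapping.lookup (fscale c p) a) (f a))"
    by (intro lext_superset) (auto simp: in_keys_iff)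
  then show ?thesis by (simp add: lext_def fsv.scale_sum_right)
qed

lemma lext_zero [simp]: "lext f 0 = 0"
  by (simp add: lext_def)

lemma lext_diff: "lext f (p - q) = lext f p - lext f q"
  using lext_add[of f "p - q" q] by (simp add: algebra_simps)

lemma lext_fun_add: "lext (\<lambda>a. f a + g a) p = lext f p + lext g p"
  by (simp add: lext_def fsv.scale_right_distrib sum.distrib)

lemma lext_fun_scale: "lext (\<lambda>a. fscale c (f a)) p = fscale c (lext f p)"
  by (simp add: lext_def fsv.scale_sum_right mult.commute)

lemma lext_subspace:
  assumes "fsv.subspace S" "\<And>a. a \<in> Poly_Mapping.keys p \<Longrightarrow> f a \<in> S"
  shows "lext f p \<in> S"
  unfolding lext_def using assms by (intro fsv.subspace_sum fsv.subspace_scale) auto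

lemma fsv_ext_induct:
  assumes "P 0" and "\<And>a. P (bvec a)"
    and "\<And>p q. P p \<Longrightarrow> P q \<Longrightarrow> P (p + q)" and "\<And>c p. P p \<Longrightarrow> P (fscale c p)"
  shows "P (p :: 'a \<Rightarrow>\<^sub>0 'k::field)"
proof -
  have sums: "P (\<Sum>a\<in>A. fscale (Poly_Mapping.lookup p a) (bvec a))" if "finite A" for A
    using that by induction (auto intro: assms)
  have "p = (\<Sum>a\<in>Poly_Mapping.keys p. fscale (Poly_Mapping.lookup p a) (bvec a))"
    by (rule poly_mapping_eqI)
      (auto simp: lookup_sum lookup_single when_def in_keys_iff if_distrib cong: if_cong)
  with sums[of "Poly_Mapping.keys p"] show ?thesis by simp
qed

lemma wbracket_linear:
  "wbracket (u + u') v = wbracket u v + wbracket u' v"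
  "wbracket u (v + v') = wbracket u v + wbracket u v'"
  "wbracket (fscale c u) v = fscale c (wbracket u v)"
  "wbracket u (fscale c v) = fscale c (wbracket u v)"
  by (simp_all add: wbracket_def lext_add lext_scale lext_fun_add lext_fun_scale)

lemma wbracket_zero [simp]: "wbracket 0 v = 0" "wbracket u 0 = 0"
  using wbracket_linear(3)[of 0 0 v] wbracket_linear(4)[of u 0 0] by simp_all

lemma symprod_linear:
  "symprod (u + u') v = symprod u v + symprod u' v"
  "symprod u (v + v') = symprod u v + symprod u v'"
  "symprod (fscale c u) v = fscale c (symprod u v)"
  "symprod u (fscale c v) = fscale c (symprod u v)"
  by (simp_all add: symprod_def lext_add lext_scale lext_fun_add lext_fun_scale)

lemma symprod_zero [simp]: "symprod 0 v = 0" "symprod u 0 = 0"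
  using symprod_linear(3)[of 0 0 v] symprod_linear(4)[of u 0 0] by simp_all

lemma wact_linear:
  "wact (w + w') v = wact w v + wact w' v"
  "wact w (v + v') = wact w v + wact w v'"
  "wact (fscale c w) v = fscale c (wact w v)"
  "wact w (fscale c v) = fscale c (wact w v)"
proof -
  show "wact w (v + v') = wact w v + wact w v'" "wact w (fscale c v) = fscale c (wact w v)"
    by (simp_all add: wact_def lext_add lext_scale)
  show "wact (w + w') v = wact w v + wact w' v" "wact (fscale c w) v = fscale c (wact w v)"
    by (simp_all add: wact_def wbracket_linear symprod_linear lext_def case_prod_unfold
        fsv.scale_right_distrib fsv.scale_sum_right sum.distrib ac_simps)
qed

lemma wact_zero [simp]: "wact 0 v = 0" "wact w 0 = 0"
  using wact_linear(3)[of 0 0 v] wact_linear(4)[of w 0 0] by simp_all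

lemma wbracket_bvec:
  "wbracket (bvec i) (bvec j) = fscale (of_nat j - of_nat i) (bvec (i + j))"
  by (simp add: wbracket_def)

lemma symprod_bvec: "symprod (bvec i) (bvec j) = bvec (min i j, max i j)"
  by (simp add: symprod_def)

lemma symprod_commute: "symprod u v = symprod v u"
proof (induction u rule: fsv_ext_induct)
  case (2 i)
  show ?case
    by (induction v rule: fsv_ext_induct)
      (simp_all add: symprod_linear symprod_bvec min.commute max.commute)
qed (simp_all add: symprod_linear)

lemma symprod_diff:
  "symprod (u - u') v = symprod u v - symprod u' v"
  "symprod u (v - v') = symprod u v - symprod u v'"
  using symprod_linear(1)[of "u - u'" u' v] symprod_linear(2)[of u "v - v'" v']
  by (simp_all add: algebra_simps)

lemma wact_symprod:
  "wact w (symprod u v) = symprod (wbracket w u) v + symprod u (wbracket w v)"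
proof (induction u rule: fsv_ext_induct)
  case (2 i)
  show ?case
  proof (induction v rule: fsv_ext_induct)
    case (2 j)
    show ?case
    proof (cases "i \<le> j")
      case True
      then show ?thesis by (simp add: wact_def symprod_bvec)
    next
      case False
      then have "wact w (symprod (bvec i) (bvec j))
          = symprod (wbracket w (bvec j)) (bvec i) + symprod (bvec j) (wbracket w (bvec i))"
        by (simp add: wact_def symprod_bvec)
      then show ?thesis
        using symprod_commute[of "wbracket w (bvec j)" "bvec i"]
          symprod_commute[of "bvec j" "wbracket w (bvec i)"]
        by (simp only: add.commute)
    qed
  qed (simp_all add: wact_linear wbracket_linear symprod_linear fsv.scale_right_distrib)
qed (simp_all add: wact_linear wbracket_linear symprod_linear fsv.scale_right_distrib)

lemma wact_bvec:
  "wact (bvec k) (symprod (bvec i) (bvec j)) =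
     fscale (of_nat i - of_nat k) (symprod (bvec (i + k)) (bvec j))
   + fscale (of_nat j - of_nat k) (symprod (bvec i) (bvec (j + k)))"
  by (simp add: wact_symprod wbracket_bvec symprod_linear add.commute)

lemma wbracket_antisym: "wbracket v u = - wbracket u v"
proof (induction u rule: fsv_ext_induct)
  case (2 i)
  show ?case
    by (induction v rule: fsv_ext_induct)
      (simp_all add: wbracket_linear wbracket_bvec add.commute flip: fsv.scale_minus_left)
qed (simp_all add: wbracket_linear)

lemma wbracket_jacobi:
  "wbracket (wbracket u v) w = wbracket u (wbracket v w) - wbracket v (wbracket u w)"
proof (induction u rule: fsv_ext_induct)
  case (2 i)
  show ?case
  proof (induction v rule: fsv_ext_induct)
    case (2 j)
    show ?case
    proof (induction w rule: fsv_ext_induct)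
      case (2 k)
      show ?case
        by (intro poly_mapping_eqI, simp only: wbracket_linear wbracket_bvec)
          (simp add: lookup_minus lookup_single when_def algebra_simps)
    qed (simp_all add: wbracket_linear fsv.scale_right_diff_distrib add_diff_add)
  qed (simp_all add: wbracket_linear fsv.scale_right_diff_distrib add_diff_add)
qed (simp_all add: wbracket_linear fsv.scale_right_diff_distrib add_diff_add)

lemma subspace_supported:
  "fsv.subspace {p. Poly_Mapping.keys (p :: 'a \<Rightarrow>\<^sub>0 'k::field) \<subseteq> A}"
proof (rule fsv.subspaceI)
  fix p q :: "'a \<Rightarrow>\<^sub>0 'k"
  assume "p \<in> {p. Poly_Mapping.keys p \<subseteq> A}" "q \<in> {p. Poly_Mapping.keys p \<subseteq> A}"
  then show "p + q \<in> {p. Poly_Mapping.keys p \<subseteq> A}"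
    using keys_add[of p q] by blast
qed (auto simp: in_keys_iff)

lemma subspace_Wplus: "fsv.subspace Wplus"
  unfolding Wplus_def by (rule subspace_supported)

lemma subspace_S2Wplus: "fsv.subspace S2Wplus"
  unfolding S2Wplus_def by (rule subspace_supported)

lemma wbracket_closed: "u \<in> Wplus \<Longrightarrow> v \<in> Wplus \<Longrightarrow> wbracket u v \<in> Wplus"
  unfolding wbracket_def
  by (intro lext_subspace fsv.subspace_scale subspace_Wplus) (auto simp: Wplus_def)

lemma symprod_closed: "u \<in> Wplus \<Longrightarrow> v \<in> Wplus \<Longrightarrow> symprod u v \<in> S2Wplus"
  unfolding symprod_def
  by (intro lext_subspace subspace_S2Wplus)
    (auto simp: Wplus_def S2Wplus_def min_def max_def subset_iff)

lemma wact_closed: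
  assumes "w \<in> Wplus" "v \<in> S2Wplus"
  shows "wact w v \<in> S2Wplus"
proof -
  have [simp]: "bvec i \<in> Wplus" if "1 \<le> i" for i
    using that by (simp add: Wplus_def)
  show ?thesis
    unfolding wact_def
  proof (rule lext_subspace[OF subspace_S2Wplus], clarify)
    fix i j assume "(i, j) \<in> Poly_Mapping.keys v"
    then have "1 \<le> i" "1 \<le> j" using assms(2) by (auto simp: S2Wplus_def)
    then show "symprod (wbracket w (bvec i)) (bvec j)
        + symprod (bvec i) (wbracket w (bvec j)) \<in> S2Wplus"
      using assms(1)
      by (intro fsv.subspace_add subspace_S2Wplus symprod_closed wbracket_closed) auto
  qed
qed

lemma wact_wbracket:
  assumes "v \<in> S2Wplus"
  shows "wact (wbracket u w) v = wact u (wact w v) - wact w (wact u v)"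
proof -
  let ?f = "\<lambda>(i, j). symprod (bvec i) (bvec j) :: nat \<times> nat \<Rightarrow>\<^sub>0 'a"
  have v: "lext ?f v = v"
  proof -
    have "lext ?f v = lext bvec v"
      unfolding lext_def using assms
      by (intro sum.cong) (auto simp: S2Wplus_def symprod_bvec subset_iff min_def max_def)
    moreover have "lext bvec v = v"
      by (induction v rule: fsv_ext_induct) (simp_all add: lext_add lext_scale)
    ultimately show ?thesis by simp
  qed
  have "wact (wbracket u w) (lext ?f p)
      = wact u (wact w (lext ?f p)) - wact w (wact u (lext ?f p))" for p
  proof (induction p rule: fsv_ext_induct)
    case (2 a)
    obtain i j where "a = (i, j)" by (cases a)
    then show ?case
      by (simp add: wact_symprod wact_linear wbracket_jacobi symprod_diff)
  next
    case (3 p q)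
    then show ?case by (simp add: lext_add wact_linear)
  next
    case (4 c p)
    then show ?case by (simp add: lext_scale wact_linear fsv.scale_right_diff_distrib)
  qed simp
  from this[of v] show ?thesis unfolding v .
qed

end

theory Submission
  imports Defs "HOL-Computational_Algebra.Polynomial"
begin

text \<open>
  Send \<open>x\<^sub>i x\<^sub>j\<close> with \<open>i + j = d\<close> to the palindromic polynomial \<open>X\<^sup>i + X\<^sup>j\<close> of formal degree \<open>d\<close>;
  passing to components of top degree, one may treat chains of graded modules of palindromic
  polynomials.  Certain combinations of the quadratic elements \<open>e\<^sub>a e\<^sub>b\<close> of the enveloping algebra act as
  second order operators that are bilinear in the argument and a symbol \<open>G\<close>, and fourth differences
  of products of two of them are multiplication operators: every submodule is stable under
  multiplication by \<open>X\<^sup>4 (X - 1)\<^sup>8 s\<close> for all palindromic \<open>s\<close>.  So a nonzero submodule contains all palindromic multiples of some nonzero \<open>g\<close>, and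
  invariance under \<open>e\<^sub>1\<close> allows one to remove from \<open>g\<close> all roots except \<open>0\<close> and \<open>1\<close>.  Modulo the
  multiples of \<open>X\<^sup>a (X - 1)\<^sup>b\<close> the orders of vanishing at \<open>0\<close> and \<open>1\<close> give a finite filtration with
  graded pieces of dimension at most one in each degree, on which all but finitely many \<open>e\<^sub>k\<close> act
  nontrivially.
\<close>

section \<open>Palindromic polynomials\<close>

definition X :: "'k::field_char_0 poly" where "X = [:0, 1:]"

lemma poly_X [simp]: "poly X x = x" and X_neq_0 [simp]: "X \<noteq> 0" and degree_X [simp]: "degree X = 1"
  by (simp_all add: X_def)

lemma X_power_eq_monom: "X ^ n = monom 1 n"
  by (simp add: X_def monom_altdef)

definition euler :: "'k::field_char_0 poly \<Rightarrow> 'k poly" where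
  "euler f = X * pderiv f"

lemma euler_simps [simp]:
  "euler 0 = 0" "euler 1 = 0" "euler (of_nat n) = 0" "euler (numeral w) = 0" "euler [:c:] = 0" "euler X = X"
  "euler (f + g) = euler f + euler g" "euler (f - g) = euler f - euler g" "euler (- f) = - euler f"
  "euler (f * g) = euler f * g + f * euler g"
  by (simp_all add: euler_def pderiv_add pderiv_diff pderiv_minus pderiv_mult algebra_simps
      pderiv_pCons X_def)

lemma euler_X_power [simp]: "euler (X ^ k) = of_nat k * X ^ k"
  by (induction k) (simp_all add: algebra_simps)

lemma poly_euler: "poly (euler f) x = x * poly (pderiv f) x"
  by (simp add: euler_def)

lemma coeff_euler: "coeff (euler f) i = of_nat i * coeff f i"
  by (cases i) (simp_all add: euler_def X_def coeff_pderiv)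

text \<open>
  Homogeneity is relative to a formal degree \<open>d\<close>, which can exceed the degree; a polynomial in \<open>X\<close>
  stands for a symmetric form in two variables with the second one set to \<open>1\<close>.
\<close>

definition pal :: "nat \<Rightarrow> 'k::field_char_0 poly \<Rightarrow> bool" where
  "pal d f \<longleftrightarrow> (\<forall>x. x \<noteq> 0 \<longrightarrow> poly f x = x ^ d * poly f (inverse x))"

lemma palD: "pal d f \<Longrightarrow> x \<noteq> 0 \<Longrightarrow> poly f x = x ^ d * poly f (inverse x)"
  unfolding pal_def by blast

lemma pal_mult:
  assumes "pal c s" "pal d f"
  shows "pal (c + d) (s * f)"
  unfolding pal_def
proof (intro allI impI)
  fix x :: 'a assume x: "x \<noteq> 0"
  show "poly (s * f) x = x ^ (c + d) * poly (s * f) (inverse x)"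
    using palD[OF assms(1) x] palD[OF assms(2) x] by (simp only: poly_mult power_add mult_ac)
qed

lemma pal_1 [simp]: "pal 0 1"
  by (simp add: pal_def)

lemma pal_X [simp]: "pal 2 X" and pal_1_plus_X [simp]: "pal 1 (1 + X)"
  unfolding pal_def by (auto simp: power2_eq_square ring_distribs)

lemma pal_X_minus_1_sq [simp]: "pal 2 ((X - 1) ^ 2)"
  unfolding pal_def
proof (intro allI impI)
  fix x :: 'a assume x: "x \<noteq> 0"
  have "x ^ 2 * (inverse x - 1) ^ 2 = (x * (inverse x - 1)) ^ 2"
    by (rule power_mult_distrib[symmetric])
  also have "x * (inverse x - 1) = 1 - x"
    using x by (simp add: right_diff_distrib)
  also have "(1 - x) ^ 2 = (x - 1) ^ 2" by (rule power2_commute)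
  finally show "poly ((X - 1) ^ 2) x = x ^ 2 * poly ((X - 1) ^ 2) (inverse x)"
    by simp
qed

lemma pal_power: "pal d f \<Longrightarrow> pal (d * n) (f ^ n)"
proof (induction n)
  case (Suc n)
  then show ?case using pal_mult[of d f "d * n" "f ^ n"] by simp
qed simp

lemma pal_reflect:
  assumes "pal d f"
  shows "X ^ degree f * f = X ^ d * reflect_poly f"
proof -
  \<comment> \<open>The extra factor \<open>X\<close> makes the identity trivial at
    \<open>x = 0\<close>, where \<open>pal\<close> says nothing.\<close>
  have "poly (X * (X ^ degree f * f)) x = poly (X * (X ^ d * reflect_poly f)) x" for x
  proof (cases "x = 0")
    case False
    have "poly (X * (X ^ degree f * f)) x = x * (x ^ degree f * poly f x)" by simp
    also have "\<dots> = poly (X * (X ^ d * reflect_poly f)) x"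
      unfolding palD[OF assms False] using False by (simp add: poly_reflect_poly_nz)
    finally show ?thesis .
  qed simp
  then have "X * (X ^ degree f * f) = X * (X ^ d * reflect_poly f)"
    by (intro poly_eq_poly_eq_iff[THEN iffD1] ext)
  then show ?thesis by (simp only: mult_cancel_left) simp
qed

lemma order_0_X_power_mult: "f \<noteq> 0 \<Longrightarrow> order 0 (X ^ n * f) = n + order 0 f"
  using order_power_n_n[of 0 n] by (simp add: order_mult X_def)

text \<open>\<open>reflect_poly f\<close> does not vanish at 0, so it suffices to compare orders at
  0 in \<open>pal_reflect\<close>. In particular a nonzero polynomial has only one formal
  degree.\<close>

lemma pal_degree_order:
  assumes "pal d f" "f \<noteq> 0"
  shows "degree f + order 0 f = d"
proof -
  have "order 0 (X ^ degree f * f) = order 0 (X ^ d * reflect_poly f)"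
    using pal_reflect[OF assms(1)] by simp
  moreover have "order 0 (reflect_poly f) = 0"
    using assms(2) by (intro order_0I) (simp add: poly_0_coeff_0)
  ultimately show ?thesis
    using assms(2) by (simp add: order_0_X_power_mult)
qed

lemma pal_degree: "pal d f \<Longrightarrow> degree f \<le> d"
  using pal_degree_order by (cases "f = 0") fastforce+

lemma pal_coeff:
  assumes "pal d f" "i \<le> d"
  shows "coeff f (d - i) = coeff f i"
proof -
  have "coeff (X ^ degree f * f) (degree f + i) = coeff f i"
    by (simp add: coeff_monom_mult X_power_eq_monom)
  moreover have "coeff (X ^ d * reflect_poly f) (degree f + i) = coeff f (d - i)"
    using assms(2) pal_degree[OF assms(1)]
    by (auto simp: coeff_monom_mult X_power_eq_monom coeff_reflect_poly
      intro!: arg_cong[where f = "coeff f"] coeff_eq_0)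
  ultimately show ?thesis using pal_reflect[OF assms(1)] by simp
qed

text \<open>By \<open>pal_degree_order\<close> the formal degree left for \<open>s\<close> is
  \<open>degree s + order 0 s\<close>; its symmetry follows by cancelling that of \<open>g\<close>
  in the reflected identity.\<close>

lemma pal_divide:
  assumes f: "pal d (g * s)" and g: "pal e g" "g * s \<noteq> 0"
  obtains c where "d = e + c" "pal c s"
proof -
  have gs: "g \<noteq> 0" "s \<noteq> 0" using g by auto
  have "d = degree g + degree s + (order 0 g + order 0 s)"
    using pal_degree_order[OF f g(2)] gs by (simp add: degree_mult_eq order_mult)
  also have "\<dots> = e + (degree s + order 0 s)"
    using pal_degree_order[OF g(1) gs(1)] by simp
  finally obtain c where d: "d = e + c" by blast
  have eq: "X ^ c * reflect_poly s = X ^ degree s * s"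
  proof -
    have "X ^ e * reflect_poly g * (X ^ c * reflect_poly s) = X ^ degree (g * s) * (g * s)"
      using pal_reflect[OF f] by (simp add: d reflect_poly_mult power_add mult_ac)
    also have "\<dots> = X ^ e * reflect_poly g * (X ^ degree s * s)"
      using pal_reflect[OF g(1)] gs by (simp add: degree_mult_eq power_add mult_ac)
    finally show ?thesis using gs by simp
  qed
  have "pal c s"
    unfolding pal_def
  proof (intro allI impI)
    fix x :: 'a assume x: "x \<noteq> 0"
    have "poly (X ^ c * reflect_poly s) x = poly (X ^ degree s * s) x" using eq by simp
    with x show "poly s x = x ^ c * poly s (inverse x)"
      by (simp add: poly_reflect_poly_nz)
  qed
  with d that show thesis by blast
qed

section \<open>Operators induced by the Witt algebra\<close>

text \<open>The action of \<open>e\<^sub>k\<close> on the component of degree \<open>d\<close>.\<close>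

definition witt_op :: "nat \<Rightarrow> nat \<Rightarrow> 'k::field_char_0 poly \<Rightarrow> 'k poly" where
  "witt_op d k f = X ^ k * (euler f - of_nat k * f) + (of_nat d - of_nat k) * f - euler f"

text \<open>
  With \<open>m = d - e\<close>, this is half the action of \<open>\<Sum>\<^sub>a G\<^sub>a e\<^sub>a e\<^bsub>e-a\<^esub>\<close> on degree \<open>d\<close> for suitable \<open>G\<close> of formal
  degree \<open>e\<close> (see \<open>quad_op_closed\<close>).  Multiplying an argument by the degree one form \<open>1 + X\<close> shifts
  \<open>m\<close> and produces the first order operator \<open>quad_op'\<close>.
\<close>

definition quad_op :: "'k::field_char_0 poly \<Rightarrow> 'k poly \<Rightarrow> 'k poly \<Rightarrow> 'k poly" where
  "quad_op m G f = m * (G * euler f - f * euler G)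
     - (G * euler (euler f) - 2 * euler G * euler f + f * euler (euler G))"

definition quad_op' :: "'k::field_char_0 poly \<Rightarrow> 'k poly \<Rightarrow> 'k poly \<Rightarrow> 'k poly" where
  "quad_op' m G f = (X - 1) * (G * euler f - f * euler G) - X * m * G * f"

lemma quad_op_one_plus_X_left:
  "quad_op (m - 1) ((1 + X) * G) f = (1 + X) * quad_op m G f + quad_op' m G f"
  "quad_op' (m - 1) ((1 + X) * G) f = (1 + X) * quad_op' m G f + 2 * X * G * f"
  unfolding quad_op_def quad_op'_def euler_simps by (simp_all add: algebra_simps)

lemma quad_op_one_plus_X_right:
  "quad_op (m + 1) G ((1 + X) * f) = (1 + X) * quad_op m G f - quad_op' m G f"
  "quad_op' (m + 1) G ((1 + X) * f) = (1 + X) * quad_op' m G f - 2 * X * G * f"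
  unfolding quad_op_def quad_op'_def euler_simps by (simp_all add: algebra_simps)

lemma quad_op_linear:
  "quad_op m G (f + g) = quad_op m G f + quad_op m G g"
  "quad_op' m G (f + g) = quad_op' m G f + quad_op' m G g"
  "quad_op m G (2 * f) = 2 * quad_op m G f"
  "quad_op' m G (2 * f) = 2 * quad_op' m G f"
  unfolding quad_op_def quad_op'_def euler_simps by (simp_all add: algebra_simps)

text \<open>
  Moving a factor \<open>1 + X\<close> from \<open>A\<close> to \<open>B\<close> in \<open>quad_op \<nu> A \<circ> quad_op \<mu> B\<close> and subtracting lowers the order by
  one; after four differences only a multiplication is left.
\<close>

definition quad_diff0 :: "'k::field_char_0 poly \<Rightarrow> 'k poly \<Rightarrow> 'k poly \<Rightarrow> 'k poly \<Rightarrow> 'k poly \<Rightarrow> 'k poly" where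
  "quad_diff0 \<mu> \<nu> A B f = quad_op \<nu> A (quad_op \<mu> B f)"

definition quad_diff1 :: "'k::field_char_0 poly \<Rightarrow> 'k poly \<Rightarrow> 'k poly \<Rightarrow> 'k poly \<Rightarrow> 'k poly \<Rightarrow> 'k poly" where
  "quad_diff1 \<mu> \<nu> A B f = quad_op (\<nu> + 1) A (quad_op' \<mu> B f) - 2 * quad_op' \<nu> A (quad_op \<mu> B f)"

definition quad_diff2 :: "'k::field_char_0 poly \<Rightarrow> 'k poly \<Rightarrow> 'k poly \<Rightarrow> 'k poly \<Rightarrow> 'k poly \<Rightarrow> 'k poly" where
  "quad_diff2 \<mu> \<nu> A B f = 2 * quad_op (\<nu> + 1 + 1) A (X * B * f) - 4 * quad_op' (\<nu> + 1) A (quad_op' \<mu> B f)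
     + 8 * X * A * quad_op \<mu> B f"

definition quad_diff3 :: "'k::field_char_0 poly \<Rightarrow> 'k poly \<Rightarrow> 'k poly \<Rightarrow> 'k poly \<Rightarrow> 'k poly \<Rightarrow> 'k poly" where
  "quad_diff3 \<mu> \<nu> A B f = 24 * X * A * quad_op' \<mu> B f - 12 * quad_op' (\<nu> + 1 + 1) A (X * B * f)"

text \<open>\<open>\<mu>\<close> and \<open>\<nu>\<close> stand for \<open>d - b\<close> and
  \<open>d + b - a\<close>, with \<open>d\<close>, \<open>b\<close>, \<open>a\<close> the formal
  degrees of \<open>f\<close>, \<open>B\<close>, \<open>A\<close>. A factor \<open>1 + X\<close>
  raises \<open>b\<close> or \<open>a\<close> by one, which explains the shifts.\<close>

lemma quad_diff_step:
  fixes A B f \<mu> \<nu> :: "'k::field_char_0 poly"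
  shows "quad_diff0 (\<mu> - 1) (\<nu> + 1) A ((1 + X) * B) f
      - quad_diff0 \<mu> (\<nu> - 1) ((1 + X) * A) B f
       = quad_diff1 \<mu> \<nu> A B f" (is ?t1)
    and "quad_diff1 (\<mu> - 1) (\<nu> + 1) A ((1 + X) * B) f
      - quad_diff1 \<mu> (\<nu> - 1) ((1 + X) * A) B f
       = quad_diff2 \<mu> \<nu> A B f" (is ?t2)
    and "quad_diff2 (\<mu> - 1) (\<nu> + 1) A ((1 + X) * B) f
      - quad_diff2 \<mu> (\<nu> - 1) ((1 + X) * A) B f
       = quad_diff3 \<mu> \<nu> A B f" (is ?t3)
    and "quad_diff3 (\<mu> - 1) (\<nu> + 1) A ((1 + X) * B) f
      - quad_diff3 \<mu> (\<nu> - 1) ((1 + X) * A) B f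
       = 96 * X ^ 2 * A * B * f" (is ?t4)
proof -
  have sh: "\<nu> - 1 + 1 = (\<nu> + 1) - 1" "(\<nu> + 1) - 1 + 1 = (\<nu> + 1 + 1) - 1" by simp_all
  have XB: "X * ((1 + X) * B) * f = (1 + X) * (X * B * f)" "2 * X * B * f = 2 * (X * B * f)"
    by (simp_all add: mult_ac)
  note eqs = sh quad_op_one_plus_X_left XB quad_op_linear quad_op_one_plus_X_right
  show ?t1 unfolding quad_diff0_def quad_diff1_def eqs by (simp add: algebra_simps)
  show ?t2 unfolding quad_diff1_def quad_diff2_def eqs by (simp add: algebra_simps)
  show ?t3 unfolding quad_diff2_def quad_diff3_def eqs by (simp add: algebra_simps)
  show ?t4 unfolding quad_diff3_def eqs by (simp add: algebra_simps power2_eq_square)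
qed

section \<open>Coefficient symmetry and sums weighted by coefficients\<close>

lemma pal_coeffI:
  assumes "degree f \<le> d" "\<And>i. i \<le> d \<Longrightarrow> coeff f (d - i) = coeff f i"
  shows "pal d f"
  unfolding pal_def
proof (intro allI impI)
  fix x :: 'a assume x: "x \<noteq> 0"
  have poly: "poly f z = (\<Sum>i\<le>d. coeff f i * z ^ i)" for z
    by (subst poly_as_sum_of_monoms'[OF assms(1), symmetric]) (simp add: poly_sum poly_monom)
  have inv: "x ^ d * inverse x ^ i = x ^ (d - i)" if "i \<le> d" for i
  proof -
    have "x ^ d * inverse x ^ i = x ^ (d - i) * (x * inverse x) ^ i"
      using that by (simp only: power_mult_distrib mult.assoc[symmetric] power_add[symmetric] le_add_diff_inverse2)
    then show ?thesis using x by simp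
  qed
  have "x ^ d * poly f (inverse x) = (\<Sum>i\<le>d. coeff f i * x ^ (d - i))"
    unfolding poly sum_distrib_left mult.left_commute[of "x ^ d"]
    by (intro sum.cong) (simp_all add: inv)
  also have "\<dots> = (\<Sum>i\<le>d. coeff f (d - i) * x ^ i)"
    by (rule sum.reindex_bij_witness[of _ "\<lambda>i. d - i" "\<lambda>i. d - i"]) auto
  also have "\<dots> = poly f x"
    unfolding poly using assms(2) by (intro sum.cong) auto
  finally show "poly f x = x ^ d * poly f (inverse x)" ..
qed

lemma coeff_X_mult: "coeff (X * f) n = (if n = 0 then 0 else coeff f (n - 1))"
  by (cases n) (simp_all add: X_def)

lemma of_nat_mult_poly: "of_nat n * f = smult (of_nat n) f" for f :: "'k::field_char_0 poly"
  by (simp add: of_nat_poly)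

lemma degree_euler_le: "degree (euler f) \<le> degree f"
  by (rule degree_le) (simp add: coeff_euler coeff_eq_0)

text \<open>In homogeneous terms this is the derivation x^2 d/dx + y^2 d/dy at y = 1, which
  preserves symmetric forms and raises degrees by one. \<open>witt_op d 1\<close> is this operator
  minus multiplication by \<open>1 + X\<close>.\<close>

lemma pal_euler:
  assumes "pal d f"
  shows "pal (d + 1) ((X - 1) * euler f + of_nat d * f)"
proof (rule pal_coeffI)
  have c: "coeff ((X - 1) * euler f + of_nat d * f) i =
     (of_nat i - 1) * (if i = 0 then 0 else coeff f (i - 1)) + (of_nat d - of_nat i) * coeff f i" for i
    unfolding of_nat_mult_poly
    by (cases i) (simp_all add: left_diff_distrib coeff_X_mult coeff_euler)
  have zero: "coeff f i = 0" if "d < i" for i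
    using pal_degree[OF assms] that by (intro coeff_eq_0) simp
  show "degree ((X - 1) * euler f + of_nat d * f) \<le> d + 1"
    by (intro degree_le allI impI, unfold c) (simp add: zero)
  fix i assume "i \<le> d + 1"
  then consider "i = 0" | "i = d + 1" | "1 \<le> i" "i \<le> d" by linarith
  then show "coeff ((X - 1) * euler f + of_nat d * f) (d + 1 - i) =
    coeff ((X - 1) * euler f + of_nat d * f) i"
  proof cases
    case 3
    then have "coeff f (d + 1 - i - 1) = coeff f i" "coeff f (d + 1 - i) = coeff f (i - 1)"
      using pal_coeff[OF assms, of i] pal_coeff[OF assms, of "i - 1"] by (simp_all add: Suc_diff_le)
    then show ?thesis
      unfolding c using 3 by (simp add: of_nat_diff algebra_simps)
  qed (unfold c, use pal_coeff[OF assms, of 0] in \<open>simp_all add: zero\<close>)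
qed

lemma sum_coeff_X_power:
  assumes "degree G \<le> e"
  shows "(\<Sum>a\<le>e. smult (coeff G a) (X ^ a * r)) = G * r"
proof -
  have "(\<Sum>a\<le>e. smult (coeff G a) (X ^ a * r)) = (\<Sum>a\<le>e. monom (coeff G a) a) * r"
    unfolding sum_distrib_right X_power_eq_monom
    by (intro sum.cong refl) (simp only: mult_smult_left[symmetric] smult_monom mult_1_right)
  then show ?thesis using poly_as_sum_of_monoms'[OF assms] by simp
qed

lemma sum_coeff_const:
  fixes G :: "'k::field_char_0 poly"
  assumes "degree G \<le> e"
  shows "(\<Sum>a\<le>e. smult (coeff G a) r) = smult (poly G 1) r"
proof -
  have "poly G 1 = (\<Sum>a\<le>e. coeff G a)"
    by (subst poly_as_sum_of_monoms'[OF assms, symmetric]) (simp only: poly_sum poly_monom power_one mult_1_right)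
  then show ?thesis by (simp add: smult_sum)
qed

text \<open>Weighting the coefficient of \<open>X ^ a\<close> by \<open>a\<close> is the Euler
  operator; without the powers of \<open>X\<close> the sums become values at 1, the moments of
  \<open>G\<close>.\<close>

lemma sum_coeff_quadratic:
  assumes "degree G \<le> e"
  shows "(\<Sum>a\<le>e. smult (coeff G a) (X ^ a * (r0 + of_nat a * r1 + of_nat a ^ 2 * r2)))
     = G * r0 + euler G * r1 + euler (euler G) * r2"
    and "(\<Sum>a\<le>e. smult (coeff G a) (r0 + of_nat a * r1 + of_nat a ^ 2 * r2))
     = smult (poly G 1) r0 + smult (poly (euler G) 1) r1 + smult (poly (euler (euler G)) 1) r2"
proof -
  have d: "degree (euler G) \<le> e" "degree (euler (euler G)) \<le> e"
    using degree_euler_le[of G] degree_euler_le[of "euler G"] assms by linarith+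
  have sq: "of_nat a ^ 2 * r2 = smult (of_nat a * of_nat a) r2" for a
    by (simp add: power2_eq_square mult.assoc of_nat_mult_poly)
  show "(\<Sum>a\<le>e. smult (coeff G a) (X ^ a * (r0 + of_nat a * r1 + of_nat a ^ 2 * r2)))
     = G * r0 + euler G * r1 + euler (euler G) * r2"
  proof -
    have "smult (coeff G a) (X ^ a * (r0 + of_nat a * r1 + of_nat a ^ 2 * r2)) =
      smult (coeff G a) (X ^ a * r0) + smult (coeff (euler G) a) (X ^ a * r1)
        + smult (coeff (euler (euler G)) a) (X ^ a * r2)" for a
      unfolding sq of_nat_mult_poly coeff_euler
      by (simp add: distrib_left smult_add_right mult.commute mult.left_commute)
    then show ?thesis
      by (simp only: sum.distrib sum_coeff_X_power[OF assms] sum_coeff_X_power[OF d(1)]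
        sum_coeff_X_power[OF d(2)])
  qed
  show "(\<Sum>a\<le>e. smult (coeff G a) (r0 + of_nat a * r1 + of_nat a ^ 2 * r2))
     = smult (poly G 1) r0 + smult (poly (euler G) 1) r1 + smult (poly (euler (euler G)) 1) r2"
  proof -
    have "smult (coeff G a) (r0 + of_nat a * r1 + of_nat a ^ 2 * r2) =
      smult (coeff G a) r0 + smult (coeff (euler G) a) r1 + smult (coeff (euler (euler G)) a) r2" for a
      unfolding sq of_nat_mult_poly coeff_euler
      by (simp add: smult_add_right mult.commute mult.left_commute)
    then show ?thesis
      by (simp only: sum.distrib sum_coeff_const[OF assms] sum_coeff_const[OF d(1)]
        sum_coeff_const[OF d(2)])
  qed
qed

text \<open>Sorting by \<open>X ^ e\<close>, \<open>X ^ a\<close>, \<open>X ^ (e - a)\<close> and 1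
  leaves factors quadratic in \<open>a\<close> or \<open>e - a\<close>, ready for
  \<open>sum_coeff_quadratic\<close>; the two middle terms are swapped by replacing \<open>a\<close>
  with \<open>e - a\<close>.\<close>

lemma witt_op_witt_op:
  fixes f :: "'k::field_char_0 poly" and a d e :: nat
  assumes "a \<le> e"
  defines "d' \<equiv> of_nat d :: 'k poly" and "e' \<equiv> of_nat e :: 'k poly"
    and "y1 \<equiv> euler f" and "y2 \<equiv> euler (euler f)"
    and "R \<equiv> \<lambda>a. ((of_nat d - of_nat e) * euler f - euler (euler f))
      + of_nat a * (2 * euler f - (of_nat d - of_nat e) * f) + of_nat a ^ 2 * (- f)"
  shows "witt_op (d + (e - a)) a (witt_op d (e - a) f) =
    X ^ e * ((y2 - e' ^ 2 * f) + of_nat a * (3 * e' * f - y1) + of_nat a ^ 2 * (- 2 * f))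
    + X ^ a * R a + X ^ (e - a) * R (e - a)
    + (((d' + e') * ((d' - e') * f - y1) - (d' - e') * y1 + y2)
       + of_nat a * ((d' + e') * f - 2 * ((d' - e') * f - y1) - y1) + of_nat a ^ 2 * (- 2 * f))"
proof -
  obtain b where e: "e = a + b" using assms(1) le_Suc_ex by blast
  show ?thesis
    unfolding witt_op_def euler_simps d'_def e'_def y1_def y2_def R_def e euler_X_power
    by (simp add: algebra_simps power_add power2_eq_square)
qed

section \<open>Graded submodules\<close>

text \<open>Abstracts the leading components of a submodule. \<open>N_0\<close> reflects that all
  indices are positive and is what gives \<open>d_pos\<close>.\<close>

locale graded_submodule =
  fixes N :: "nat \<Rightarrow> 'k::field_char_0 poly set"
  assumes zero: "0 \<in> N d"
    and add: "f \<in> N d \<Longrightarrow> g \<in> N d \<Longrightarrow> f + g \<in> N d"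
    and smult: "f \<in> N d \<Longrightarrow> smult c f \<in> N d"
    and witt_op: "f \<in> N d \<Longrightarrow> 0 < k \<Longrightarrow> witt_op d k f \<in> N (d + k)"
    and pal: "f \<in> N d \<Longrightarrow> pal d f"
    and N_0: "N 0 \<subseteq> {0}"
begin

lemma diff: "f \<in> N d \<Longrightarrow> g \<in> N d \<Longrightarrow> f - g \<in> N d"
  using add[of f d "- g"] smult[of g d "- 1"] by simp

lemma sum: "(\<And>i. i \<in> I \<Longrightarrow> f i \<in> N d) \<Longrightarrow> (\<Sum>i\<in>I. f i) \<in> N d"
  by (induction I rule: infinite_finite_induct) (auto intro: zero add)

text \<open>The factor \<open>X\<close> and the symmetry kill the outer coefficients, so only
  positive indices \<open>a\<close> and \<open>e - a\<close> occur; the triple zero at 1 kills the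
  moments of orders 0, 1 and 2.\<close>

definition admissible :: "nat \<Rightarrow> 'k poly \<Rightarrow> bool" where
  "admissible e G \<longleftrightarrow> pal e G \<and> X dvd G \<and> (X - 1) ^ 3 dvd G"

lemma admissible_one_plus_X: "admissible e G \<Longrightarrow> admissible (e + 1) ((1 + X) * G)"
  unfolding admissible_def using pal_mult[OF pal_1_plus_X, of e G] by (simp add: add.commute)

text \<open>In the sum of \<open>witt_op_witt_op\<close> against the coefficients of
  \<open>G\<close>, the vanishing moments remove the outer parts and the symmetry of
  \<open>G\<close> makes the two middle parts equal, whence twice \<open>quad_op\<close>.\<close>

lemma quad_op_closed:
  assumes "admissible e G" "f \<in> N d"
  shows "quad_op (of_nat d - of_nat e) G f \<in> N (d + e)"
proof -
  let ?m = "of_nat d - of_nat e :: 'k poly"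
  have G: "pal e G" "X dvd G" "(X - 1) ^ 3 dvd G" using assms(1) by (auto simp: admissible_def)
  have deg: "degree G \<le> e" using G pal_degree by auto
  have G0: "coeff G 0 = 0" using G(2) by (auto simp: coeff_X_mult elim!: dvdE)
  have Ge: "coeff G e = 0" using pal_coeff[OF G(1), of 0] G0 by simp
  have moments: "poly G 1 = 0" "poly (euler G) 1 = 0" "poly (euler (euler G)) 1 = 0"
    using G(3) by (auto simp: power3_eq_cube elim!: dvdE)
  let ?R = "\<lambda>a. X ^ a * ((?m * euler f - euler (euler f)) + of_nat a * (2 * euler f - ?m * f)
      + of_nat a ^ 2 * (- f))"
  have L: "(\<Sum>a\<le>e. smult (coeff G a) (?R a)) = quad_op ?m G f"
    unfolding sum_coeff_quadratic(1)[OF deg] quad_op_def by (simp add: algebra_simps)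
  have "(\<Sum>a\<le>e. smult (coeff G a) (?R (e - a))) = (\<Sum>a\<le>e. smult (coeff G (e - a)) (?R a))"
    by (rule sum.reindex_bij_witness[of _ "\<lambda>i. e - i" "\<lambda>i. e - i"]) auto
  also have "\<dots> = (\<Sum>a\<le>e. smult (coeff G a) (?R a))"
    using pal_coeff[OF G(1)] by (intro sum.cong) auto
  finally have L': "(\<Sum>a\<le>e. smult (coeff G a) (?R (e - a))) = quad_op ?m G f" unfolding L .
  have Q0: "(\<Sum>a\<le>e. smult (coeff G a) (r0 + of_nat a * r1 + of_nat a ^ 2 * r2)) = 0" for r0 r1 r2
    using sum_coeff_quadratic(2)[OF deg, of r0 r1 r2] moments by simp
  have X0: "(\<Sum>a\<le>e. smult (coeff G a) (X ^ e * (r0 + of_nat a * r1 + of_nat a ^ 2 * r2))) = 0" for r0 r1 r2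
    using Q0[of "X ^ e * r0" "X ^ e * r1" "X ^ e * r2"]
    by (simp only: distrib_left mult.left_commute)
  have "(\<Sum>a\<le>e. smult (coeff G a) (witt_op (d + (e - a)) a (witt_op d (e - a) f))) = 2 * quad_op ?m G f"
  proof -
    \<comment> \<open>Both zeros are expanded into the vanishing sums for \<open>X ^ e\<close> and
      for the constant part, so that the two sides agree summand by summand.\<close>
    have "(\<Sum>a\<le>e. smult (coeff G a) (witt_op (d + (e - a)) a (witt_op d (e - a) f)))
      = 0 + (\<Sum>a\<le>e. smult (coeff G a) (?R a)) + (\<Sum>a\<le>e. smult (coeff G a) (?R (e - a))) + 0"
      by (subst X0[symmetric], subst Q0[symmetric], unfold sum.distrib[symmetric] smult_add_right[symmetric])
        (intro sum.cong refl arg_cong2[where f = smult], rule witt_op_witt_op, simp)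
    then show ?thesis unfolding L L' by simp
  qed
  moreover have "(\<Sum>a\<le>e. smult (coeff G a) (witt_op (d + (e - a)) a (witt_op d (e - a) f))) \<in> N (d + e)"
  proof (rule sum)
    fix a assume "a \<in> {..e}"
    then consider "a = 0" | "a = e" | "0 < a" "a < e" by fastforce
    then show "smult (coeff G a) (witt_op (d + (e - a)) a (witt_op d (e - a) f)) \<in> N (d + e)"
    proof cases
      case 3
      then show ?thesis
        using witt_op[OF witt_op[OF assms(2), of "e - a"], of a] by (simp add: smult)
    qed (simp_all add: G0 Ge zero)
  qed
  ultimately have "smult (1 / 2) (2 * quad_op ?m G f) \<in> N (d + e)" by (simp add: smult)
  then show ?thesis by (simp add: numeral_poly)
qed

text \<open>Attaching \<open>1 + X\<close> to \<open>B\<close> or to \<open>A\<close> raises the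
  target degree by one in either case, so the two terms can be subtracted inside one
  component.\<close>

lemma difference_closed:
  fixes D D' :: "'k poly \<Rightarrow> 'k poly \<Rightarrow> 'k poly \<Rightarrow> 'k poly \<Rightarrow> 'k poly \<Rightarrow> 'k poly"
  assumes D: "\<And>a A b B. admissible a A \<Longrightarrow> admissible b B \<Longrightarrow>
      D (of_nat d - of_nat b) (of_nat (d + b) - of_nat a) A B f \<in> N (d + b + a + i)"
    and D': "\<And>\<mu> \<nu> A B. D (\<mu> - 1) (\<nu> + 1) A ((1 + X) * B) f - D \<mu> (\<nu> - 1) ((1 + X) * A) B f = D' \<mu> \<nu> A B f"
    and "admissible a A" "admissible b B"
  shows "D' (of_nat d - of_nat b) (of_nat (d + b) - of_nat a) A B f \<in> N (d + b + a + Suc i)"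
proof -
  have eqs: "of_nat d - of_nat (b + 1) = of_nat d - of_nat b - (1 :: 'k poly)"
    "of_nat (d + (b + 1)) - of_nat a = of_nat (d + b) - of_nat a + (1 :: 'k poly)"
    "of_nat (d + b) - of_nat (a + 1) = of_nat (d + b) - of_nat a - (1 :: 'k poly)"
    "d + (b + 1) + a + i = d + b + a + Suc i" "d + b + (a + 1) + i = d + b + a + Suc i"
    by simp_all
  show ?thesis
    unfolding D'[symmetric]
    by (rule diff[OF D[OF assms(3) admissible_one_plus_X[OF assms(4)], unfolded eqs]
          D[OF admissible_one_plus_X[OF assms(3)] assms(4), unfolded eqs]])
qed

text \<open>Four differences turn the composite of two second order operators into multiplication by
  \<open>96 * X ^ 2 * A * B\<close>, and 96 is invertible.\<close>

lemma mult_closed: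
  assumes "admissible a A" "admissible b B" "f \<in> N d"
  shows "X ^ 2 * A * B * f \<in> N (d + b + a + 4)"
proof -
  have D0: "quad_diff0 (of_nat d - of_nat b) (of_nat (d + b) - of_nat a) A B f \<in> N (d + b + a + 0)"
    if "admissible a A" "admissible b B" for a A b B
    unfolding quad_diff0_def using quad_op_closed[OF that(1) quad_op_closed[OF that(2) assms(3)]] by simp
  have D1: "quad_diff1 (of_nat d - of_nat b) (of_nat (d + b) - of_nat a) A B f \<in> N (d + b + a + Suc 0)"
    if "admissible a A" "admissible b B" for a A b B
    by (rule difference_closed[where D = quad_diff0 and D' = quad_diff1
            and d = d and f = f and i = 0, OF D0 quad_diff_step(1) that])
  have D2: "quad_diff2 (of_nat d - of_nat b) (of_nat (d + b) - of_nat a) A B f \<in> N (d + b + a + Suc (Suc 0))"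
    if "admissible a A" "admissible b B" for a A b B
    by (rule difference_closed[where D = quad_diff1 and D' = quad_diff2
            and d = d and f = f and i = "Suc 0", OF D1 quad_diff_step(2) that])
  have D3: "quad_diff3 (of_nat d - of_nat b) (of_nat (d + b) - of_nat a) A B f
      \<in> N (d + b + a + Suc (Suc (Suc 0)))"
    if "admissible a A" "admissible b B" for a A b B
    by (rule difference_closed[where D = quad_diff2 and D' = quad_diff3
            and d = d and f = f and i = "Suc (Suc 0)", OF D2 quad_diff_step(3) that])
  have "96 * X ^ 2 * A * B * f \<in> N (d + b + a + Suc (Suc (Suc (Suc 0))))"
    by (rule difference_closed[where D = quad_diff3 and D' = "\<lambda>\<mu> \<nu> A B f. 96 * X ^ 2 * A * B * f"
            and d = d and f = f and i = "Suc (Suc (Suc 0))", OF D3 quad_diff_step(4) assms(1,2)])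
  moreover have "d + b + a + Suc (Suc (Suc (Suc 0))) = d + b + a + 4" by simp
  ultimately have "96 * X ^ 2 * A * B * f \<in> N (d + b + a + 4)" by (simp only:)
  from smult[OF this, of "1 / 96"] show ?thesis by (simp add: numeral_poly mult.assoc)
qed

section \<open>Ideals of palindromic multiples inside a graded submodule\<close>

definition absorbs :: "nat \<Rightarrow> 'k poly \<Rightarrow> bool" where
  "absorbs d g \<longleftrightarrow> (\<forall>c s. pal c s \<longrightarrow> g * s \<in> N (d + c))"

lemma absorbsD: "absorbs d g \<Longrightarrow> pal c s \<Longrightarrow> g * s \<in> N (d + c)"
  by (simp add: absorbs_def)

lemma absorbs_pal: "absorbs d g \<Longrightarrow> pal d g"
  using absorbsD[of d g 0 1] pal[of g d] by simp

lemma absorbs_mult: "absorbs d g \<Longrightarrow> pal c s \<Longrightarrow> absorbs (d + c) (g * s)"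
  unfolding absorbs_def using pal_mult[of c s] by (metis add.assoc mult.assoc)

lemma absorbs_diff: "absorbs d g \<Longrightarrow> absorbs d h \<Longrightarrow> absorbs d (g - h)"
  unfolding absorbs_def by (simp add: left_diff_distrib diff)

lemma absorbs_smult: "absorbs d g \<Longrightarrow> absorbs d (smult c g)"
  unfolding absorbs_def by (simp add: smult)

lemma absorbs_of_nat_mult: "absorbs d g \<Longrightarrow> absorbs d (of_nat n * g)"
  unfolding of_nat_mult_poly by (rule absorbs_smult)

text \<open>Leibniz rule: the derivation of \<open>pal_euler\<close> applied to \<open>g\<close> and
  multiplied by \<open>s\<close> is its value on \<open>g * s\<close> minus \<open>g\<close> times
  its value on \<open>s\<close>. The first is supplied by \<open>witt_op (d + c) 1\<close> up to the
  factor \<open>1 + X\<close>.\<close>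

lemma absorbs_euler:
  assumes "absorbs d g"
  shows "absorbs (d + 1) ((X - 1) * euler g + of_nat d * g)"
  unfolding absorbs_def
proof (intro allI impI)
  fix c and s :: "'k poly" assume s: "pal c s"
  define s' where "s' = ((X - 1) * euler s + of_nat c * s) - (1 + X) * s"
  have "g * ((X - 1) * euler s + of_nat c * s) \<in> N (d + c + 1)"
    using absorbsD[OF assms pal_euler[OF s]] by simp
  moreover have "g * ((1 + X) * s) \<in> N (d + c + 1)"
    using absorbsD[OF assms pal_mult[OF pal_1_plus_X s]] by simp
  ultimately have "g * s' \<in> N (d + c + 1)"
    unfolding s'_def right_diff_distrib by (rule diff)
  moreover have "witt_op (d + c) 1 (g * s) \<in> N (d + c + 1)"
    using witt_op[OF absorbsD[OF assms s], of 1] by simp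
  ultimately have "witt_op (d + c) 1 (g * s) - g * s' \<in> N (d + c + 1)"
    by (rule diff[rotated])
  moreover have "witt_op (d + c) 1 (g * s) - g * s' = ((X - 1) * euler g + of_nat d * g) * s"
    unfolding witt_op_def s'_def by (simp add: algebra_simps)
  ultimately show "((X - 1) * euler g + of_nat d * g) * s \<in> N (d + 1 + c)" by (simp add: add_ac)
qed

text \<open>The arbitrary multiplier \<open>s\<close> is put into the first symbol of
  \<open>mult_closed\<close>, which stays admissible.\<close>

lemma absorbs_exists:
  assumes "f \<in> N d"
  shows "absorbs (d + 16) (X ^ 4 * (X - 1) ^ 8 * f)"
  unfolding absorbs_def
proof (intro allI impI)
  fix c and s :: "'k poly" assume s: "pal c s"
  \<comment> \<open>Palindromic powers of \<open>X - 1\<close> have even exponent, and admissibility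
    asks for at least 3.\<close>
  let ?B = "X * (X - 1) ^ 4 :: 'k poly"
  have "pal (2 + 2 * 2) (X * ((X - 1) ^ 2) ^ 2 :: 'k poly)"
    by (intro pal_mult pal_power) simp_all
  then have B: "admissible 6 ?B" unfolding admissible_def by (auto simp: power_mult[symmetric] le_imp_power_dvd)
  then have A: "admissible (6 + c) (?B * s)" unfolding admissible_def using pal_mult s by auto
  have "X ^ 2 * (?B * s) * ?B * f \<in> N (d + 6 + (6 + c) + 4)" by (rule mult_closed[OF A B assms])
  also have "X ^ 2 * (?B * s) * ?B * f = X ^ 4 * (X - 1) ^ 8 * f * s"
    by (simp add: power_numeral_reduce mult_ac)
  finally show "X ^ 4 * (X - 1) ^ 8 * f * s \<in> N (d + 16 + c)" by (simp add: add_ac)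
qed

text \<open>
  The Euler operator replaces the cofactor \<open>h\<close> by \<open>(X - 1) h' - (deg h) h\<close>, of smaller degree because
  the leading terms cancel and nonzero because its value at \<open>1\<close> is \<open>- (deg h) h(1)\<close>.
\<close>

lemma absorbs_descent:
  assumes "absorbs (2 * a + b + degree h) (X ^ a * (X - 1) ^ b * h)" "poly h 0 \<noteq> 0" "poly h 1 \<noteq> 0"
  shows "\<exists>a. absorbs (2 * a + b) (X ^ a * (X - 1) ^ b)"
  using assms
proof (induction "degree h" arbitrary: h a rule: less_induct)
  case less
  show ?case
  proof (cases "degree h = 0")
    case True
    then obtain c where c: "h = [:c:]" by (auto elim: degree_eq_zeroE)
    then have "c \<noteq> 0" using less.prems by auto
    then have "smult (inverse c) (X ^ a * (X - 1) ^ b * h) = X ^ a * (X - 1) ^ b"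
      unfolding c by (simp add: mult.commute)
    then show ?thesis using absorbs_smult[OF less.prems(1), of "inverse c"] True by auto
  next
    case False
    let ?n = "degree h"
    let ?D = "X ^ a * (X - 1) ^ b :: 'k poly"
    let ?d = "2 * a + b + ?n"
    define y where "y = (X - 1) * pderiv h - of_nat ?n * h"
    have y1: "poly y 1 \<noteq> 0" using False less.prems(3) by (simp add: y_def)
    then have y0: "y \<noteq> 0" by auto
    have "coeff y i = 0" if "i \<ge> ?n" for i
    proof (cases "i = ?n")
      case True
      have "coeff (pderiv h) ?n = 0" by (simp add: coeff_pderiv coeff_eq_0)
      moreover have "of_nat (Suc (?n - 1)) = (of_nat ?n :: 'k)" using False by simp
      ultimately show ?thesis using False unfolding True y_def of_nat_mult_poly
        by (simp add: left_diff_distrib coeff_X_mult coeff_pderiv)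
    next
      case False
      with that have "i > ?n" by simp
      then show ?thesis unfolding y_def of_nat_mult_poly
        by (simp add: left_diff_distrib coeff_X_mult coeff_pderiv coeff_eq_0)
    qed
    then have deg: "degree y < ?n" using False y0 by (meson leading_coeff_0_iff not_le)
    \<comment> \<open>The zeros of \<open>y\<close> at 0 are moved into the power of
      \<open>X\<close>, as the induction hypothesis asks for a cofactor not vanishing there.\<close>
    obtain z where z: "y = X ^ order 0 y * z" "\<not> X dvd z"
      using order_decomp[OF y0, of 0] by (auto simp: X_def)
    define k where "k = order 0 y"
    have yz: "y = X ^ k * z" using z k_def by simp
    have z0: "poly z 0 \<noteq> 0" using z(2) by (simp add: poly_eq_0_iff_dvd X_def)
    then have zn: "z \<noteq> 0" by auto
    have z1: "poly z 1 \<noteq> 0" using y1 yz by simp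
    have X1: "euler ((X - 1) ^ b) * (X - 1) = of_nat b * X * (X - 1) ^ b"
      by (induction b) (simp_all add: algebra_simps)
    \<comment> \<open>The multiple of \<open>1 + X\<close> is chosen to cancel the term
      \<open>(a + b + ?n) * ?D * h\<close>; what remains is divisible by \<open>X\<close>.\<close>
    have step: "X * (?D * y) = ((X - 1) * euler (?D * h) + of_nat ?d * (?D * h))
        - of_nat (a + b + ?n) * (?D * h * (1 + X))"
    proof -
      have "(X - 1) * euler (?D * h) = of_nat a * (X - 1) * ?D * h
          + X ^ a * (euler ((X - 1) ^ b) * (X - 1)) * h + ?D * ((X - 1) * euler h)"
        by (simp add: algebra_simps)
      also have "\<dots> = of_nat a * (X - 1) * ?D * h + of_nat b * X * ?D * h + ?D * (X * ((X - 1) * pderiv h))"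
        unfolding X1 by (simp add: euler_def mult_ac)
      finally show ?thesis unfolding y_def by (simp add: algebra_simps)
    qed
    have "absorbs (?d + 1) (X * (?D * y))"
      unfolding step
      by (intro absorbs_diff absorbs_of_nat_mult absorbs_euler[OF less.prems(1)]
          absorbs_mult[OF less.prems(1) pal_1_plus_X])
    also have "X * (?D * y) = X ^ (a + k + 1) * (X - 1) ^ b * z"
      unfolding yz by (simp add: power_add mult_ac)
    finally have ab: "absorbs (?d + 1) (X ^ (a + k + 1) * (X - 1) ^ b * z)" .
    have X1n: "X - 1 \<noteq> (0 :: 'k poly)" "degree (X - 1 :: 'k poly) = 1" by (simp_all add: X_def one_pCons)
    \<comment> \<open>The formal degree in terms of the new exponents is recovered as degree plus
      order at 0.\<close>
    have "degree (X ^ (a + k + 1) * ((X - 1) ^ b * z)) = (a + k + 1) + b + degree z"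
      using zn X1n by (simp add: degree_mult_eq degree_power_eq)
    moreover have "order 0 (X ^ (a + k + 1) * ((X - 1) ^ b * z)) = a + k + 1"
      using zn X1n z0 by (subst order_0_X_power_mult) (auto intro!: order_0I)
    ultimately have "?d + 1 = 2 * (a + k + 1) + b + degree z"
      using pal_degree_order[OF absorbs_pal[OF ab]] zn X1n by (simp add: mult.assoc)
    then have ab': "absorbs (2 * (a + k + 1) + b + degree z) (X ^ (a + k + 1) * (X - 1) ^ b * z)"
      using ab by (simp only:)
    have "degree y = k + degree z" unfolding yz using zn by (simp add: degree_mult_eq degree_power_eq)
    with deg have "degree z < ?n" by simp
    from less.hyps[OF this ab' z0 z1] show ?thesis .
  qed
qed

text \<open>Splitting off all zeros at 0 and 1 from the absorbed multiple of \<open>f\<close> leaves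
  a cofactor that \<open>absorbs_descent\<close> removes.\<close>

lemma absorbs_X_power_X_minus_1_power:
  assumes "f \<in> N d" "f \<noteq> 0"
  obtains a b where "absorbs (2 * a + b) (X ^ a * (X - 1) ^ b)"
proof -
  define g where "g = X ^ 4 * (X - 1) ^ 8 * f"
  have X1n: "X - 1 \<noteq> (0 :: 'k poly)" "degree (X - 1 :: 'k poly) = 1" by (simp_all add: X_def one_pCons)
  have g: "absorbs (d + 16) g" "g \<noteq> 0"
    unfolding g_def using absorbs_exists[OF assms(1)] assms(2) X1n by simp_all
  obtain a y where y: "g = X ^ a * y" "\<not> X dvd y"
    using order_decomp[OF g(2), of 0] by (auto simp: X_def)
  then have "y \<noteq> 0" by auto
  then obtain b h where h: "y = (X - 1) ^ b * h" "\<not> X - 1 dvd h"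
    using order_decomp[of y 1] by (auto simp: X_def one_pCons)
  have h0: "poly h 0 \<noteq> 0" "poly h 1 \<noteq> 0"
  proof -
    have "poly y 0 \<noteq> 0" using y(2) by (simp add: poly_eq_0_iff_dvd X_def)
    then show "poly h 0 \<noteq> 0" unfolding h(1) by simp
    show "poly h 1 \<noteq> 0" using h(2) by (simp add: poly_eq_0_iff_dvd X_def one_pCons)
  qed
  then have hn: "h \<noteq> 0" by auto
  have gh: "g = X ^ a * ((X - 1) ^ b * h)" using y h by simp
  have "degree g = a + b + degree h"
    unfolding gh using hn X1n by (simp add: degree_mult_eq degree_power_eq)
  moreover have "order 0 g = a"
    unfolding gh using hn X1n h0 by (subst order_0_X_power_mult) (auto intro!: order_0I)
  ultimately have "d + 16 = 2 * a + b + degree h"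
    using pal_degree_order[OF absorbs_pal[OF g(1)] g(2)] by simp
  then have "absorbs (2 * a + b + degree h) (X ^ a * (X - 1) ^ b * h)"
    using g(1) gh by (simp add: mult.assoc)
  from absorbs_descent[OF this h0] that show thesis by blast
qed

lemma d_pos: "f \<in> N d \<Longrightarrow> f \<noteq> 0 \<Longrightarrow> 0 < d"
  using N_0 by (cases d) auto

end

section \<open>Chains of graded submodules\<close>

text \<open>\<open>flag_poly a l\<close> runs through a chain of divisors of
  \<open>X ^ a * (X - 1) ^ b\<close> for \<open>l\<close> up to \<open>a + b\<close>, adding first
  the zeros at 0 and then those at 1; \<open>root_at a l\<close> is the zero added at step
  \<open>l\<close>.\<close>

definition root_at :: "nat \<Rightarrow> nat \<Rightarrow> 'k::field_char_0" where
  "root_at a l = (if l < a then 0 else 1)"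

definition flag_poly :: "nat \<Rightarrow> nat \<Rightarrow> 'k::field_char_0 poly" where
  "flag_poly a l = X ^ min l a * (X - 1) ^ (l - a)"

lemma flag_poly_neq_0: "flag_poly a l \<noteq> (0 :: 'k::field_char_0 poly)"
  by (simp add: flag_poly_def X_def one_pCons)

lemma flag_poly_Suc: "flag_poly a (Suc l) = flag_poly a l * (X - [:root_at a l:])"
  by (cases "l < a")
    (simp_all add: flag_poly_def root_at_def min_def Suc_diff_le mult_ac one_pCons[symmetric])

lemma flag_poly_Suc_dvd: "flag_poly a (Suc l) dvd flag_poly a l * y \<longleftrightarrow> poly y (root_at a l) = 0"
proof -
  have root: "X - [:root_at a l:] = [:- root_at a l, 1:]" by (simp add: X_def)
  show ?thesis
    unfolding flag_poly_Suc root dvd_mult_cancel_left poly_eq_0_iff_dvd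
    by (simp only: flag_poly_neq_0 simp_thms)
qed

text \<open>The Euler operator preserves the order at 0, and its coefficient
  \<open>X ^ k - 1\<close> vanishes at 1. So both orders are kept and the leading values at 0 and 1
  are multiplied by scalars.\<close>

lemma witt_op_flag:
  fixes y :: "'k::field_char_0 poly"
  assumes "0 < k"
  obtains w where "witt_op d k (X ^ a * (X - 1) ^ b * y) = X ^ a * (X - 1) ^ b * w"
    "poly w 0 = (of_nat d - of_nat k - of_nat a) * poly y 0"
    "poly w 1 = (of_nat d + of_nat b * of_nat k - 2 * of_nat k) * poly y 1"
proof -
  define S where "S = (\<Sum>i<k. X ^ i :: 'k poly)"
  define w where "w = X ^ k * (of_nat a * y + euler y - of_nat k * y)
    + (of_nat d - of_nat k - of_nat a) * y - euler y + of_nat b * X * S * y"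
  have XS: "X ^ k = 1 + (X - 1) * S" unfolding S_def power_diff_1_eq[symmetric] by simp
  have X1: "(X - 1) * euler ((X - 1) ^ b) = of_nat b * X * (X - 1) ^ b"
    by (induction b) (simp_all add: algebra_simps)
  have "witt_op d k (X ^ a * (X - 1) ^ b * y) = X ^ a * (X - 1) ^ b *
      (X ^ k * (of_nat a * y + euler y - of_nat k * y) + (of_nat d - of_nat k - of_nat a) * y - euler y)
    + (X ^ k - 1) * X ^ a * euler ((X - 1) ^ b) * y"
    unfolding witt_op_def by (simp add: algebra_simps)
  also have "(X ^ k - 1) * X ^ a * euler ((X - 1) ^ b) * y
      = X ^ a * ((X - 1) * euler ((X - 1) ^ b)) * S * y"
    unfolding XS by (simp add: mult_ac)
  also have "\<dots> = X ^ a * (X - 1) ^ b * (of_nat b * X * S * y)"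
    unfolding X1 by (simp add: mult_ac)
  finally have "witt_op d k (X ^ a * (X - 1) ^ b * y) = X ^ a * (X - 1) ^ b * w"
    unfolding w_def by (simp add: distrib_left)
  moreover have "poly w 0 = (of_nat d - of_nat k - of_nat a) * poly y 0"
    using assms unfolding w_def by (simp add: poly_euler)
  moreover have "poly w 1 = (of_nat d + of_nat b * of_nat k - 2 * of_nat k) * poly y 1"
    unfolding w_def S_def by (simp add: poly_sum algebra_simps)
  ultimately show thesis by (rule that)
qed

text \<open>The degrees in which the \<open>l\<close>-th piece of the filtration is nonzero. The
  value of the cofactor at \<open>root_at a l\<close> embeds each piece into the field, so these
  degrees determine its dimensions.\<close>

definition leaf :: "(nat \<Rightarrow> 'k::field_char_0 poly set) \<Rightarrow> nat \<Rightarrow> nat \<Rightarrow> nat set" where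
  "leaf N a l = {d. \<exists>f\<in>N d. flag_poly a l dvd f \<and> \<not> flag_poly a (Suc l) dvd f}"

lemma (in graded_submodule) leaf_closed:
  assumes "d \<in> leaf N a l" "d < k"
  shows "d + k \<in> leaf N a l"
proof -
  obtain f where f: "f \<in> N d" "flag_poly a l dvd f" "\<not> flag_poly a (Suc l) dvd f"
    using assms(1) by (auto simp: leaf_def)
  then obtain y where y: "f = flag_poly a l * y" by blast
  then have y0: "poly y (root_at a l) \<noteq> 0" using f(3) flag_poly_Suc_dvd by blast
  have "f \<noteq> 0" using f(3) by auto
  then have d: "0 < d" using d_pos f(1) by blast
  have k: "0 < k" using assms(2) by simp
  obtain w where w: "witt_op d k f = flag_poly a l * w"
    "poly w 0 = (of_nat d - of_nat k - of_nat (min l a)) * poly y 0"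
    "poly w 1 = (of_nat d + of_nat (l - a) * of_nat k - 2 * of_nat k) * poly y 1"
    using witt_op_flag[OF k, of d "min l a" "l - a" y] unfolding y flag_poly_def by metis
  have "poly w (root_at a l) \<noteq> 0"
  proof (cases "l < a")
    case True
    have "of_nat d \<noteq> (of_nat (k + l) :: 'k)" using assms(2) by (simp only: of_nat_eq_iff)
    then have "of_nat d - of_nat k - of_nat l \<noteq> (0 :: 'k)" by (simp add: diff_diff_eq)
    then show ?thesis using True y0 w(2) by (simp add: root_at_def)
  next
    case False
    \<comment> \<open>Orders 0 and 1 are excluded by \<open>d < k\<close>, larger orders by
      \<open>0 < d\<close>.\<close>
    have "d + (l - a) * k \<noteq> 2 * k"
    proof -
      consider "l - a = 0" | "l - a = 1" | m where "l - a = m + 2"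
        by (metis One_nat_def add_2_eq_Suc' not0_implies_Suc)
      then show ?thesis using d assms(2) by cases (auto simp: algebra_simps)
    qed
    then have "of_nat (d + (l - a) * k) \<noteq> (of_nat (2 * k) :: 'k)" by (simp only: of_nat_eq_iff not_False_eq_True)
    then show ?thesis using False y0 w(3) by (simp add: root_at_def)
  qed
  then have "\<not> flag_poly a (Suc l) dvd witt_op d k f" unfolding w(1) flag_poly_Suc_dvd .
  moreover have "flag_poly a l dvd witt_op d k f" unfolding w(1) by simp
  ultimately show ?thesis using witt_op[OF f(1) k] by (auto simp: leaf_def)
qed

section \<open>Increasing chains of sets of degrees\<close>

lemma finite_subset_chain:
  assumes "\<And>n. Z n \<subseteq> Z (Suc n :: nat)" "finite F" "F \<subseteq> (\<Union>n. Z n)"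
  shows "\<exists>m. F \<subseteq> Z m"
  using assms(2,3)
proof (induction F)
  case (insert x F)
  then obtain m n where "F \<subseteq> Z m" "x \<in> Z n" by auto
  moreover have "Z m \<subseteq> Z (max m n)" "Z n \<subseteq> Z (max m n)"
    using lift_Suc_mono_le[of Z, OF assms(1)] by simp_all
  ultimately show ?case by blast
qed simp

text \<open>Once \<open>d\<close> belongs to a set of the chain, so does every number above
  \<open>2 * d\<close>; only finitely many numbers can still be added.\<close>

lemma nat_set_chain_stabilises:
  fixes Z :: "nat \<Rightarrow> nat set"
  assumes chain: "\<And>n. Z n \<subseteq> Z (Suc n)"
    and closed: "\<And>n d k. d \<in> Z n \<Longrightarrow> d < k \<Longrightarrow> d + k \<in> Z n"
  shows "\<exists>m. \<forall>n\<ge>m. Z n = Z m"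
proof (cases "\<exists>n. Z n \<noteq> {}")
  case True
  then obtain m d where d: "d \<in> Z m" by blast
  have mono: "Z i \<subseteq> Z j" if "i \<le> j" for i j
    using lift_Suc_mono_le[of Z, OF chain that] .
  obtain m' where m': "(\<Union>n. Z n) \<inter> {..2 * d} \<subseteq> Z m'"
    using finite_subset_chain[of Z "(\<Union>n. Z n) \<inter> {..2 * d}"] chain by auto
  define M where "M = max m m'"
  have "x \<in> Z M" if "x \<in> Z n" for x n
  proof (cases "x \<le> 2 * d")
    case True
    then show ?thesis using m' that mono[of m' M] by (auto simp: M_def)
  next
    case False
    have "d \<in> Z M" using d mono[of m M] by (auto simp: M_def)
    from closed[OF this, of "x - d"] show ?thesis using False by simp
  qed
  then have "\<forall>n\<ge>M. Z n = Z M" using mono by blast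
  then show ?thesis ..
qed blast

text \<open>Some stage contains all palindromic multiples of one \<open>X ^ a * (X - 1) ^ b\<close>,
  so only the \<open>a + b\<close> sets \<open>leaf\<close> matter, and each of them
  stabilises.\<close>

lemma graded_chain_stabilises:
  fixes N :: "nat \<Rightarrow> nat \<Rightarrow> 'k::field_char_0 poly set"
  assumes gr: "\<And>n. graded_submodule (N n)" and chain: "\<And>n d. N n d \<subseteq> N (Suc n) d"
  shows "\<exists>m. \<forall>n\<ge>m. N n = N m"
proof (cases "\<exists>n d. \<exists>f\<in>N n d. f \<noteq> 0")
  case False
  then have "N n d = {0}" for n d using graded_submodule.zero[OF gr, of n d] by blast
  then have "\<forall>n\<ge>0. N n = N 0" by (auto simp: fun_eq_iff)
  then show ?thesis ..
next
  case True
  then obtain n0 d0 f0 where f0: "f0 \<in> N n0 d0" "f0 \<noteq> 0" by blast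
  obtain a b where ab: "graded_submodule.absorbs (N n0) (2 * a + b) (X ^ a * (X - 1) ^ b)"
    using graded_submodule.absorbs_X_power_X_minus_1_power[OF gr f0] by blast
  let ?g = "X ^ a * (X - 1) ^ b :: 'k poly"
  have g: "flag_poly a (a + b) = ?g" by (simp add: flag_poly_def)
  have mono: "N i d \<subseteq> N j d" if "i \<le> j" for i j d
    using lift_Suc_mono_le[of "\<lambda>n. N n d", OF chain that] .
  have "\<exists>m. \<forall>n\<ge>m. leaf (N n) a l = leaf (N m) a l" for l
  proof (rule nat_set_chain_stabilises)
    show "leaf (N n) a l \<subseteq> leaf (N (Suc n)) a l" for n
      unfolding leaf_def using chain by blast
  qed (rule graded_submodule.leaf_closed[OF gr])
  then obtain m where m: "\<And>l n. n \<ge> m l \<Longrightarrow> leaf (N n) a l = leaf (N (m l)) a l" by metis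
  \<comment> \<open>If \<open>a + b = 0\<close>, the inner maximum is an unspecified number, but
    then \<open>leaf_M\<close> is vacuous.\<close>
  define M where "M = max n0 (Max (m ` {..<a + b}))"
  have leaf_M: "leaf (N n) a l = leaf (N M) a l" if "n \<ge> M" "l < a + b" for n l
  proof -
    have "m l \<le> M" unfolding M_def using that by (intro max.coboundedI2 Max_ge) auto
    then show ?thesis using m[of l n] m[of l M] that by simp
  qed
  have "f \<in> N M d" if "n \<ge> M" "l \<le> a + b" "f \<in> N n d" "flag_poly a l dvd f" for n d l f
    using that(2-4)
  proof (induction l arbitrary: f rule: inc_induct)
    case base
    show ?case
    proof (cases "f = 0")
      case True
      then show ?thesis using graded_submodule.zero[OF gr] by simp
    next
      case False
      obtain s where s: "f = ?g * s" using base(2) unfolding g by blast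
      \<comment> \<open>The quotient of palindromic polynomials is palindromic, so the absorption at
        stage \<open>n0\<close> applies to it.\<close>
      obtain c where c: "d = 2 * a + b + c" "pal c s"
        using pal_divide[of d ?g s "2 * a + b"] graded_submodule.pal[OF gr base(1)]
          graded_submodule.absorbs_pal[OF gr ab] s False by auto
      have "f \<in> N n0 d"
        unfolding s c(1) by (rule graded_submodule.absorbsD[OF gr ab c(2)])
      then show ?thesis using mono[of n0 M d] by (auto simp: M_def)
    qed
  next
    case (step l)
    show ?case
    proof (cases "flag_poly a (Suc l) dvd f")
      case True
      then show ?thesis using step.IH[of f] step.prems by blast
    next
      case False
      then have "d \<in> leaf (N M) a l"
        using step.prems step.hyps leaf_M[OF that(1), of l] by (auto simp: leaf_def)
      then obtain f' where f': "f' \<in> N M d" "flag_poly a l dvd f'" "\<not> flag_poly a (Suc l) dvd f'"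
        by (auto simp: leaf_def)
      obtain y y' where y: "f = flag_poly a l * y" "f' = flag_poly a l * y'"
        using step.prems f' by blast
      have "poly y' (root_at a l) \<noteq> 0" using f'(3) unfolding y flag_poly_Suc_dvd .
      \<comment> \<open>This scalar matches the values at the root, so the difference lies one step
        deeper in the filtration.\<close>
      define c where "c = poly y (root_at a l) / poly y' (root_at a l)"
      have cf': "smult c f' \<in> N M d" using graded_submodule.smult[OF gr f'(1)] .
      have "f - smult c f' = flag_poly a l * (y - smult c y')"
        unfolding y by (simp add: right_diff_distrib)
      moreover have "poly (y - smult c y') (root_at a l) = 0"
        using \<open>poly y' (root_at a l) \<noteq> 0\<close> by (simp add: c_def)
      ultimately have "flag_poly a (Suc l) dvd f - smult c f'"
        using flag_poly_Suc_dvd by metis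
      moreover have "f - smult c f' \<in> N n d"
        using graded_submodule.diff[OF gr step.prems(1)] cf' mono[OF that(1)] by blast
      ultimately have "f - smult c f' \<in> N M d" using step.IH by blast
      from graded_submodule.add[OF gr this cf'] show ?thesis by simp
    qed
  qed
  from this[of _ 0] have "N n d \<subseteq> N M d" if "n \<ge> M" for n d
    using that by (auto simp: flag_poly_def)
  then have "\<forall>n\<ge>M. N n = N M" using mono by (simp add: fun_eq_iff set_eq_subset)
  then show ?thesis ..
qed

section \<open>Passing to leading components\<close>

text \<open>The symmetrisation map with the second variable set to 1. Squares go to twice a
  monomial, so its injectivity relies on 2 being nonzero.\<close>

definition component :: "nat \<Rightarrow> (nat \<times> nat \<Rightarrow>\<^sub>0 'k::field_char_0) \<Rightarrow> 'k poly" where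
  "component d v = (\<Sum>i\<le>d. smult (Poly_Mapping.lookup v (i, d - i)) (X ^ i + X ^ (d - i)))"

lemma component_linear [simp]:
  "component d 0 = 0" "component d (v + w) = component d v + component d w"
  "component d (v - w) = component d v - component d w" "component d (fscale c v) = smult c (component d v)"
proof -
  show "component d (v + w) = component d v + component d w"
    by (simp add: component_def lookup_add smult_add_left sum.distrib)
  show "component d (v - w) = component d v - component d w"
    by (simp add: component_def lookup_minus smult_diff_left sum_subtractf)
  show "component d (fscale c v) = smult c (component d v)"
    by (rule poly_eqI) (simp add: component_def coeff_sum sum_distrib_left mult.assoc)
qed (simp add: component_def)

lemma component_bvec: "component d (bvec (i, j)) = (if i + j = d then X ^ i + X ^ j else 0)"
proof -
  have "component d (bvec (i, j)) = (\<Sum>l\<le>d. if l = i then (if i + j = d then X ^ i + X ^ j else 0) else 0)"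
    unfolding component_def by (intro sum.cong) (auto simp: lookup_single when_def)
  then show ?thesis by (cases "i \<le> d") auto
qed

lemma component_wact: "component (d + k) (wact (bvec k) v) = witt_op d k (component d v)"
proof (induction v rule: fsv_ext_induct)
  case (2 a)
  obtain i j where a: "a = (i, j)" by (cases a)
  have mm: "component (d + k) (bvec (min p q, max p q)) = component (d + k) (bvec (p, q))" for p q
    by (simp add: component_bvec min_def max_def add.commute)
  have "component (d + k) (wact (bvec k) (bvec (i, j)))
    = smult (of_nat i - of_nat k) (component (d + k) (bvec (k + i, j)))
      + smult (of_nat j - of_nat k) (component (d + k) (bvec (i, k + j)))"
    by (simp add: wact_def wbracket_bvec symprod_linear symprod_bvec mm)
  also have "\<dots> = witt_op d k (component d (bvec (i, j)))"
    by (auto simp: component_bvec witt_op_def algebra_simps power_add smult_diff_left of_nat_mult_poly[symmetric])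
  finally show ?case unfolding a .
next
  case (3 p q)
  then show ?case by (simp add: wact_linear) (simp add: witt_op_def algebra_simps)
next
  case (4 c p)
  then show ?case by (simp add: wact_linear)
      (simp add: witt_op_def smult_add_right smult_diff_right right_diff_distrib euler_def pderiv_smult)
qed (simp add: witt_op_def)

lemma coeff_component:
  assumes "i \<le> d"
  shows "coeff (component d v) i = Poly_Mapping.lookup v (i, d - i) + Poly_Mapping.lookup v (d - i, i)"
proof -
  have "coeff (component d v) i = (\<Sum>l\<le>d. (if l = i then Poly_Mapping.lookup v (i, d - i) else 0)
      + (if l = d - i then Poly_Mapping.lookup v (d - i, i) else 0))"
    unfolding component_def coeff_sum using assms
    by (intro sum.cong) (auto simp: X_power_eq_monom)
  then show ?thesis using assms by (simp add: sum.distrib)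
qed

lemma pal_component: "pal d (component d v)"
proof (rule pal_coeffI)
  show "degree (component d v) \<le> d"
    unfolding component_def
    by (intro degree_sum_le order.trans[OF degree_smult_le] degree_add_le)
      (auto simp: X_power_eq_monom degree_monom_eq)
qed (simp add: coeff_component)

lemma component_inject:
  assumes "v \<in> S2Wplus" "\<And>d. component d v = 0"
  shows "v = 0"
proof (rule poly_mapping_eqI)
  fix ij :: "nat \<times> nat"
  obtain i j where ij: "ij = (i, j)" by (cases ij)
  have z: "Poly_Mapping.lookup v (i, j) = 0" if "j < i" for i j
    using assms(1) that by (auto simp: S2Wplus_def in_keys_iff)
  have "Poly_Mapping.lookup v (i, j) + Poly_Mapping.lookup v (j, i) = 0"
    using coeff_component[of i "i + j" v] assms(2) by simp
  then show "Poly_Mapping.lookup v ij = Poly_Mapping.lookup 0 ij"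
    unfolding ij using z[of i j] z[of j i] by (cases i j rule: linorder_cases) auto
qed

text \<open>Analogue of leading terms for submodules that need not be graded. Asking only for
  vanishing above \<open>d\<close> lets zero in and makes this a subspace.\<close>

definition lead :: "(nat \<times> nat \<Rightarrow>\<^sub>0 'k::field_char_0) set \<Rightarrow> nat \<Rightarrow> 'k poly set" where
  "lead N d = {component d v | v. v \<in> N \<and> (\<forall>d'>d. component d' v = 0)}"

text \<open>The action of \<open>bvec k\<close> shifts every component by exactly \<open>k\<close>,
  so it carries top components to top components.\<close>

lemma graded_submodule_lead:
  assumes "S2_submodule N"
  shows "graded_submodule (lead N)"
proof
  have N: "N \<subseteq> S2Wplus" "fsv.subspace N" and act: "\<And>w v. w \<in> Wplus \<Longrightarrow> v \<in> N \<Longrightarrow> wact w v \<in> N"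
    using assms by (auto simp: S2_submodule_def)
  fix d k :: nat and c :: 'a and f g :: "'a poly"
  show "0 \<in> lead N d"
    unfolding lead_def using fsv.subspace_0[OF N(2)] by (force intro: exI[of _ 0])
  show "f + g \<in> lead N d" if "f \<in> lead N d" "g \<in> lead N d"
  proof -
    obtain v w where "v \<in> N" "w \<in> N" "\<forall>d'>d. component d' v = 0" "\<forall>d'>d. component d' w = 0"
      "f = component d v" "g = component d w"
      using \<open>f \<in> lead N d\<close> \<open>g \<in> lead N d\<close> by (auto simp: lead_def)
    then show ?thesis unfolding lead_def using fsv.subspace_add[OF N(2), of v w]
      by (intro CollectI exI[of _ "v + w"]) simp
  qed
  assume "f \<in> lead N d"
  then obtain v where v: "v \<in> N" "\<forall>d'>d. component d' v = 0" "f = component d v"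
    by (auto simp: lead_def)
  show "smult c f \<in> lead N d"
    unfolding lead_def using v fsv.subspace_scale[OF N(2), of v c]
    by (intro CollectI exI[of _ "fscale c v"]) simp
  show "pal d f" unfolding v(3) by (rule pal_component)
  assume "0 < k"
  then have "wact (bvec k) v \<in> N" using v(1) by (intro act) (auto simp: Wplus_def)
  moreover have "component d' (wact (bvec k) v) = 0" if "d' > d + k" for d'
    using component_wact[of "d' - k" k v] that v(2) by (simp add: witt_op_def)
  ultimately show "witt_op d k f \<in> lead N (d + k)"
    unfolding lead_def v(3) component_wact[symmetric] by blast
next
  have "component 0 v = 0" if "v \<in> N" for v
  proof -
    have "Poly_Mapping.lookup v (0, 0) = 0"
      using assms that by (force simp: S2_submodule_def S2Wplus_def in_keys_iff)
    then show ?thesis by (simp add: component_def)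
  qed
  then show "lead N 0 \<subseteq> {0}" by (auto simp: lead_def)
qed

lemma lead_mono: "N \<subseteq> N' \<Longrightarrow> lead N d \<subseteq> lead N' d"
  by (auto simp: lead_def)

text \<open>Induction on a degree bound: subtracting an element of \<open>N\<close> with the same
  leading component lowers the bound.\<close>

lemma lead_eq_imp_subset:
  assumes N: "S2_submodule N" "S2_submodule N'" and sub: "N \<subseteq> N'" and eq: "lead N = lead N'"
  shows "N' \<subseteq> N"
proof
  have "v \<in> N" if "v \<in> N'" "\<forall>d\<ge>D. component d v = 0" for v D
    using that
  proof (induction D arbitrary: v)
    case 0
    then have "v = 0" using component_inject[of v] N(2) by (auto simp: S2_submodule_def)
    then show ?case using N(1) fsv.subspace_0 by (auto simp: S2_submodule_def)
  next
    case (Suc D)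
    then have "component D v \<in> lead N D" unfolding eq by (auto simp: lead_def)
    then obtain w where w: "w \<in> N" "\<forall>d>D. component d w = 0" "component D w = component D v"
      by (auto simp: lead_def)
    have "component d (v - w) = 0" if "d \<ge> D" for d
      using that Suc.prems(2) w by (cases "d = D") auto
    moreover have "v - w \<in> N'"
      using N(2) Suc.prems(1) w(1) sub fsv.subspace_diff by (auto simp: S2_submodule_def)
    ultimately have "v - w \<in> N" using Suc.IH by blast
    with w(1) N(1) fsv.subspace_add[of N "v - w" w] show ?case by (simp add: S2_submodule_def)
  qed
  note step = this
  fix v assume "v \<in> N'"
  \<comment> \<open>A bound above all degrees in the support; for \<open>v = 0\<close> its value is
    unspecified and every bound works.\<close>
  moreover define D where "D = Suc (Max ((\<lambda>(i, j). i + j) ` Poly_Mapping.keys v))"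
  have "component d v = 0" if "d \<ge> D" for d
    unfolding component_def
  proof (intro sum.neutral ballI)
    fix i assume "i \<in> {..d}"
    have "(i, d - i) \<notin> Poly_Mapping.keys v"
    proof
      assume "(i, d - i) \<in> Poly_Mapping.keys v"
      then have "d \<le> Max ((\<lambda>(i, j). i + j) ` Poly_Mapping.keys v)"
        using \<open>i \<in> {..d}\<close> by (intro Max_ge) force+
      with that show False by (simp add: D_def)
    qed
    then show "smult (Poly_Mapping.lookup v (i, d - i)) (X ^ i + X ^ (d - i)) = 0"
      by (simp add: in_keys_iff)
  qed
  ultimately show "v \<in> N" using step by blast
qed

theorem theorem4p2:
  fixes N :: "nat \<Rightarrow> (nat \<times> nat \<Rightarrow>\<^sub>0 'k::field_char_0) set"
  assumes "\<And>n. S2_submodule (N n)"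
    and "\<And>n. N n \<subseteq> N (Suc n)"
  shows "\<exists>m. \<forall>n\<ge>m. N n = N m"
proof -
  obtain m where m: "\<And>n. n \<ge> m \<Longrightarrow> lead (N n) = lead (N m)"
    using graded_chain_stabilises[of "\<lambda>n. lead (N n)"] graded_submodule_lead[OF assms(1)]
      lead_mono[OF assms(2)] by blast
  have "N n = N m" if "n \<ge> m" for n
  proof
    show "N m \<subseteq> N n" using lift_Suc_mono_le[of N, OF assms(2) that] .
    then show "N n \<subseteq> N m"
      using lead_eq_imp_subset[OF assms(1) assms(1)] m[OF that] by metis
  qed
  then show ?thesis by blast
qed

end
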